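(* The inclusion functor $\mathbf{Frm}\to\mathbf{OSR}_{\mathrm{sa}}$, sending a frame $(F,\leq)$ to the ordered semiring $(F,\leq,\bot,\top,\vee,\wedge)$ and a frame homomorphism to itself, has a left adjoint $\mathrm{Rad}\colon\mathbf{OSR}_{\mathrm{sa}}\to\mathbf{Frm}$, which sends each ordered semiring $A$ to the frame $\mathrm{Rad}(A)$ of radical ideals of $A$.
   Context: Semirings are commutative and unital: $(A,0,+)$ and $(A,1,\cdot)$ are commutative monoids with $x\cdot 0=0$ and $x(y+z)=xy+xz$. An ordered semiring is a tuple $(A,\leq,0,1,+,\cdot)$ where $(A,0,1,+,\cdot)$ is a semiring and $\leq$ is a preorder on $A$ with respect to which $+$ and $\cdot$ are monotone. A subadditive morphism $f\colon A\to B$ between ordered semirings is a monotone function with $f(0_A)\leq 0_B$, $f(1_A)=1_B$, $f(x+y)\leq f(x)+f(y)$ and $f(xy)=f(x)f(y)$ for all $x,y\in A$. $\mathbf{OSR}_{\mathrm{sa}}$ is the category of ordered semirings and subadditive morphisms. A frame is a complete lattice $(F,\leq)$ in which $x\wedge\bigvee_\lambda y_\lambda=\bigvee_\lambda (x\wedge y_\lambda)$ for all $x\in F$ and all families $(y_\lambda)$. A frame homomorphism is a function preserving arbitrary joins and finite meets. $\mathbf{Frm}$ is the category of frames and frame homomorphisms. An ideal of an ordered semiring $A$ is a subset $I\subseteq A$ such that: $x\leq y\in I$ implies $x\in I$; $0\in I$; $x,y\in I$ implies $x+y\in I$; and if $x\in I$ or $y\in I$ then $xy\in I$. An ideal $I$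 is radical if for all $x\in A$ and $n\in\mathbb{N}$, $x^n\in I$ implies $x\in I$. $\mathrm{Rad}(A)$ is the set of all radical ideals of $A$ ordered by inclusion; it is a frame. *)

theory Defs
  imports "HOL-Algebra.Complete_Lattice" "HOL-Algebra.Ring"
begin

section \<open>Ordered semirings and subadditive morphisms\<close>

record 'a ord_semiring = "'a ring" +
  ord_le :: "['a, 'a] \<Rightarrow> bool" (infixl \<open>\<preceq>\<index>\<close> 50)

text \<open>The relation is only a preorder; antisymmetry is not required.\<close>

locale ord_semiring = semiring A + comm_monoid A for A (structure) +
  assumes ord_refl: "x \<in> carrier A \<Longrightarrow> x \<preceq> x"
    and ord_trans: "\<lbrakk>x \<preceq> y; y \<preceq> z; x \<in> carrier A; y \<in> carrier A; z \<in> carrier A\<rbrakk> \<Longrightarrow> x \<preceq> z"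
    and add_mono: "\<lbrakk>x \<preceq> x'; y \<preceq> y'; x \<in> carrier A; x' \<in> carrier A; y \<in> carrier A; y' \<in> carrier A\<rbrakk>
      \<Longrightarrow> x \<oplus> y \<preceq> x' \<oplus> y'"
    and mult_mono: "\<lbrakk>x \<preceq> x'; y \<preceq> y'; x \<in> carrier A; x' \<in> carrier A; y \<in> carrier A; y' \<in> carrier A\<rbrakk>
      \<Longrightarrow> x \<otimes> y \<preceq> x' \<otimes> y'"

text \<open>Morphisms are extensional functions, so that equality of morphisms is
  equality of functions on the carrier. The hom-set is meant for \<open>A\<close>, \<open>B\<close>
  satisfying \<^const>\<open>ord_semiring\<close>; the two may live on different types.\<close>

definition OSR_hom :: "'a ord_semiring \<Rightarrow> 'b ord_semiring \<Rightarrow> ('a \<Rightarrow> 'b) set" where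
  "OSR_hom A B = {f \<in> carrier A \<rightarrow>\<^sub>E carrier B.
     (\<forall>x\<in>carrier A. \<forall>y\<in>carrier A. x \<preceq>\<^bsub>A\<^esub> y \<longrightarrow> f x \<preceq>\<^bsub>B\<^esub> f y) \<and>
     f \<zero>\<^bsub>A\<^esub> \<preceq>\<^bsub>B\<^esub> \<zero>\<^bsub>B\<^esub> \<and>
     f \<one>\<^bsub>A\<^esub> = \<one>\<^bsub>B\<^esub> \<and>
     (\<forall>x\<in>carrier A. \<forall>y\<in>carrier A. f (x \<oplus>\<^bsub>A\<^esub> y) \<preceq>\<^bsub>B\<^esub> f x \<oplus>\<^bsub>B\<^esub> f y) \<and>
     (\<forall>x\<in>carrier A. \<forall>y\<in>carrier A. f (x \<otimes>\<^bsub>A\<^esub> y) = f x \<otimes>\<^bsub>B\<^esub> f y)}"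

text \<open>Identity and composition are those of functions in both categories.\<close>

definition id_mor :: "('a, 'm) partial_object_scheme \<Rightarrow> 'a \<Rightarrow> 'a" where
  "id_mor X = (\<lambda>x\<in>carrier X. x)"

definition comp_mor :: "('a, 'm) partial_object_scheme \<Rightarrow> ('b \<Rightarrow> 'c) \<Rightarrow> ('a \<Rightarrow> 'b) \<Rightarrow> 'a \<Rightarrow> 'c" where
  "comp_mor X g f = compose (carrier X) g f"

lemma id_mor_OSR_hom:
  assumes "ord_semiring A" shows "id_mor A \<in> OSR_hom A A"
proof -
  interpret ord_semiring A by fact
  show ?thesis by (auto simp: OSR_hom_def id_mor_def intro: ord_refl)
qed

lemma comp_mor_OSR_hom:
  assumes "ord_semiring A" "ord_semiring B" "ord_semiring C"
    and f: "f \<in> OSR_hom A B" and g: "g \<in> OSR_hom B C"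
  shows "comp_mor A g f \<in> OSR_hom A C"
proof -
  interpret A: ord_semiring A by fact
  interpret B: ord_semiring B by fact
  interpret C: ord_semiring C by fact
  have fc: "f x \<in> carrier B" if "x \<in> carrier A" for x
    using f that by (auto simp: OSR_hom_def)
  have gc: "g x \<in> carrier C" if "x \<in> carrier B" for x
    using g that by (auto simp: OSR_hom_def)
  have gm: "g x \<preceq>\<^bsub>C\<^esub> g y" if "x \<preceq>\<^bsub>B\<^esub> y" "x \<in> carrier B" "y \<in> carrier B" for x y
    using g that by (auto simp: OSR_hom_def)
  have zero: "g (f \<zero>\<^bsub>A\<^esub>) \<preceq>\<^bsub>C\<^esub> \<zero>\<^bsub>C\<^esub>"
  proof (rule C.ord_trans)
    show "g (f \<zero>\<^bsub>A\<^esub>) \<preceq>\<^bsub>C\<^esub> g \<zero>\<^bsub>B\<^esub>"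
      using f by (intro gm fc) (auto simp: OSR_hom_def)
    show "g \<zero>\<^bsub>B\<^esub> \<preceq>\<^bsub>C\<^esub> \<zero>\<^bsub>C\<^esub>" using g by (simp add: OSR_hom_def)
  qed (auto intro: fc gc)
  have add: "g (f (x \<oplus>\<^bsub>A\<^esub> y)) \<preceq>\<^bsub>C\<^esub> g (f x) \<oplus>\<^bsub>C\<^esub> g (f y)"
    if xy: "x \<in> carrier A" "y \<in> carrier A" for x y
  proof (rule C.ord_trans)
    show "g (f (x \<oplus>\<^bsub>A\<^esub> y)) \<preceq>\<^bsub>C\<^esub> g (f x \<oplus>\<^bsub>B\<^esub> f y)"
      using f xy by (intro gm fc) (auto simp: OSR_hom_def)
    show "g (f x \<oplus>\<^bsub>B\<^esub> f y) \<preceq>\<^bsub>C\<^esub> g (f x) \<oplus>\<^bsub>C\<^esub> g (f y)"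
      using g fc xy by (simp add: OSR_hom_def)
  qed (use xy in \<open>auto intro: fc gc\<close>)
  show ?thesis
    using f g zero add fc gc
    by (auto simp: OSR_hom_def comp_mor_def compose_def)
qed

section \<open>Frames\<close>

locale frame = complete_lattice L for L (structure) +
  assumes meet_sup_distrib: "\<lbrakk>x \<in> carrier L; Y \<subseteq> carrier L\<rbrakk> \<Longrightarrow> x \<sqinter> \<Squnion>Y = \<Squnion>((\<lambda>y. x \<sqinter> y) ` Y)"

text \<open>Preservation of finite meets is preservation of the empty meet \<open>\<top>\<close> and of binary meets.\<close>

definition Frm_hom :: "'a gorder \<Rightarrow> 'b gorder \<Rightarrow> ('a \<Rightarrow> 'b) set" where
  "Frm_hom F G = {h \<in> carrier F \<rightarrow>\<^sub>E carrier G.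
     (\<forall>Y. Y \<subseteq> carrier F \<longrightarrow> h (\<Squnion>\<^bsub>F\<^esub>Y) = \<Squnion>\<^bsub>G\<^esub>(h ` Y)) \<and>
     h \<top>\<^bsub>F\<^esub> = \<top>\<^bsub>G\<^esub> \<and>
     (\<forall>x\<in>carrier F. \<forall>y\<in>carrier F. h (x \<sqinter>\<^bsub>F\<^esub> y) = h x \<sqinter>\<^bsub>G\<^esub> h y)}"

lemma id_mor_Frm_hom:
  assumes "frame F" shows "id_mor F \<in> Frm_hom F F"
proof -
  interpret frame F by fact
  have *: "(\<lambda>x\<in>carrier F. x) (\<Squnion>\<^bsub>F\<^esub>Y) = \<Squnion>\<^bsub>F\<^esub>((\<lambda>x\<in>carrier F. x) ` Y)" if "Y \<subseteq> carrier F" for Y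
  proof -
    have "(\<lambda>x\<in>carrier F. x) ` Y = Y" using that by force
    then show ?thesis using that by (simp only: restrict_apply sup_closed if_True)
  qed
  show ?thesis unfolding Frm_hom_def id_mor_def
    by (intro CollectI conjI allI impI *) auto
qed

lemma comp_mor_Frm_hom:
  assumes "frame F" "frame G" "frame H"
    and f: "f \<in> Frm_hom F G" and g: "g \<in> Frm_hom G H"
  shows "comp_mor F g f \<in> Frm_hom F H"
proof -
  interpret F: frame F by fact
  interpret G: frame G by fact
  have fc: "f x \<in> carrier G" if "x \<in> carrier F" for x
    using f that by (auto simp: Frm_hom_def)
  have gc: "g x \<in> carrier H" if "x \<in> carrier G" for x
    using g that by (auto simp: Frm_hom_def)
  have sup: "compose (carrier F) g f (\<Squnion>\<^bsub>F\<^esub>Y) = \<Squnion>\<^bsub>H\<^esub>(compose (carrier F) g f ` Y)"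
    if Y: "Y \<subseteq> carrier F" for Y
  proof -
    have "compose (carrier F) g f (\<Squnion>\<^bsub>F\<^esub>Y) = g (\<Squnion>\<^bsub>G\<^esub>(f ` Y))"
      using f Y by (auto simp: Frm_hom_def compose_def)
    also have "\<dots> = \<Squnion>\<^bsub>H\<^esub>(g ` f ` Y)"
    proof -
      have "f ` Y \<subseteq> carrier G" using fc Y by auto
      then show ?thesis using g by (auto simp: Frm_hom_def)
    qed
    also have "g ` f ` Y = compose (carrier F) g f ` Y"
      using Y by (force simp: compose_def)
    finally show ?thesis .
  qed
  have fin: "g (f \<top>\<^bsub>F\<^esub>) = \<top>\<^bsub>H\<^esub>"
    "\<And>x y. \<lbrakk>x \<in> carrier F; y \<in> carrier F\<rbrakk> \<Longrightarrow> g (f (x \<sqinter>\<^bsub>F\<^esub> y)) = g (f x) \<sqinter>\<^bsub>H\<^esub> g (f y)"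
    using f g fc by (simp_all add: Frm_hom_def)
  show ?thesis
    using sup fin fc gc by (auto simp: Frm_hom_def comp_mor_def) (auto simp: compose_def)
qed

text \<open>Object part of the inclusion functor; the morphism part sends a frame homomorphism to itself.\<close>

definition frame_osr :: "'a gorder \<Rightarrow> 'a ord_semiring" where
  "frame_osr F = \<lparr>carrier = carrier F,
     mult = (\<sqinter>\<^bsub>F\<^esub>), one = \<top>\<^bsub>F\<^esub>, zero = \<bottom>\<^bsub>F\<^esub>, add = (\<squnion>\<^bsub>F\<^esub>), ord_le = (\<sqsubseteq>\<^bsub>F\<^esub>)\<rparr>"

section \<open>Radical ideals\<close>

definition osr_ideal :: "'a ord_semiring \<Rightarrow> 'a set \<Rightarrow> bool" where
  "osr_ideal A I \<longleftrightarrow> I \<subseteq> carrier A \<and>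
     (\<forall>x\<in>carrier A. \<forall>y\<in>I. x \<preceq>\<^bsub>A\<^esub> y \<longrightarrow> x \<in> I) \<and>
     \<zero>\<^bsub>A\<^esub> \<in> I \<and>
     (\<forall>x\<in>I. \<forall>y\<in>I. x \<oplus>\<^bsub>A\<^esub> y \<in> I) \<and>
     (\<forall>x\<in>carrier A. \<forall>y\<in>carrier A. x \<in> I \<or> y \<in> I \<longrightarrow> x \<otimes>\<^bsub>A\<^esub> y \<in> I)"

text \<open>The exponent 0 is harmless: if \<open>\<one> \<in> I\<close> then \<open>I\<close> is the whole carrier.\<close>

definition radical_ideal :: "'a ord_semiring \<Rightarrow> 'a set \<Rightarrow> bool" where
  "radical_ideal A I \<longleftrightarrow> osr_ideal A I \<and>
     (\<forall>x\<in>carrier A. \<forall>n::nat. x [^]\<^bsub>A\<^esub> n \<in> I \<longrightarrow> x \<in> I)"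

definition Rad :: "'a ord_semiring \<Rightarrow> 'a set gorder" where
  "Rad A = \<lparr>carrier = {I. radical_ideal A I}, eq = (=), le = (\<subseteq>)\<rparr>"

definition rad_gen :: "'a ord_semiring \<Rightarrow> 'a set \<Rightarrow> 'a set" where
  "rad_gen A S = \<Inter>{I. radical_ideal A I \<and> S \<subseteq> I}"

text \<open>Morphism part of the functor \<^const>\<open>Rad\<close>.\<close>

definition Rad_map :: "'a ord_semiring \<Rightarrow> 'b ord_semiring \<Rightarrow> ('a \<Rightarrow> 'b) \<Rightarrow> 'a set \<Rightarrow> 'b set" where
  "Rad_map A B f = (\<lambda>I\<in>carrier (Rad A). rad_gen B (f ` I))"

text \<open>The unit sends an element to the radical ideal it generates; transposition is
  precomposition with the unit.\<close>

definition Rad_unit :: "'a ord_semiring \<Rightarrow> 'a \<Rightarrow> 'a set" where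
  "Rad_unit A = (\<lambda>a\<in>carrier A. rad_gen A {a})"

definition Rad_transpose :: "'a ord_semiring \<Rightarrow> ('a set \<Rightarrow> 'b) \<Rightarrow> 'a \<Rightarrow> 'b" where
  "Rad_transpose A g = comp_mor A g (Rad_unit A)"

end

theory Submission
  imports Defs
begin

text \<open>Membership in a colon \<open>{x. \<forall>y\<in>S. x y \<in> K}\<close> of a radical ideal \<open>K\<close> defines a radical
  ideal again, so a statement about the radical ideal generated by \<open>T\<close> need only be checked on
  \<open>T\<close>; together with \<open>x\<^sup>2 \<in> K \<Longrightarrow> x \<in> K\<close> this yields the frame law of \<open>Rad A\<close> and
  \<open>\<langle>ab\<rangle> = \<langle>a\<rangle> \<inter> \<langle>b\<rangle>\<close> without an explicit description of generated radical ideals.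
  A subadditive morphism \<open>f\<close> from \<open>A\<close> to a frame extends along \<open>a \<mapsto> \<langle>a\<rangle>\<close> to
  \<open>I \<mapsto> \<Squnion>(f ` I)\<close>, because the sets \<open>{x. f x \<sqsubseteq> u}\<close> are radical ideals; the extension is unique
  because \<open>I\<close> is the join of the \<open>\<langle>a\<rangle>\<close> with \<open>a \<in> I\<close>.\<close>

section \<open>Frames as ordered semirings\<close>

lemma frame_osr_simps [simp]:
  "carrier (frame_osr F) = carrier F"
  "mult (frame_osr F) = (\<sqinter>\<^bsub>F\<^esub>)"
  "one (frame_osr F) = \<top>\<^bsub>F\<^esub>"
  "zero (frame_osr F) = \<bottom>\<^bsub>F\<^esub>"
  "add (frame_osr F) = (\<squnion>\<^bsub>F\<^esub>)"
  "ord_le (frame_osr F) = (\<sqsubseteq>\<^bsub>F\<^esub>)"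
  by (simp_all add: frame_osr_def)

context frame
begin

lemma sup_eqI:
  assumes "Y \<subseteq> carrier L" "s \<in> carrier L" "\<And>y. y \<in> Y \<Longrightarrow> y \<sqsubseteq> s"
    and "\<And>z. \<lbrakk>z \<in> carrier L; \<And>y. y \<in> Y \<Longrightarrow> y \<sqsubseteq> z\<rbrakk> \<Longrightarrow> s \<sqsubseteq> z"
  shows "\<Squnion>Y = s"
proof (rule le_antisym)
  show "\<Squnion>Y \<sqsubseteq> s" using assms by (intro sup_least)
  show "s \<sqsubseteq> \<Squnion>Y" using assms by (intro assms(4) sup_upper sup_closed)
qed (use assms in \<open>auto intro: sup_closed\<close>)

lemma meet_mono:
  assumes "x \<sqsubseteq> x'" "y \<sqsubseteq> y'" "x \<in> carrier L" "x' \<in> carrier L" "y \<in> carrier L" "y' \<in> carrier L"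
  shows "x \<sqinter> y \<sqsubseteq> x' \<sqinter> y'"
proof (rule meet_le)
  show "x \<sqinter> y \<sqsubseteq> x'"
    by (rule le_trans[OF meet_left assms(1)]) (use assms in auto)
  show "x \<sqinter> y \<sqsubseteq> y'"
    by (rule le_trans[OF meet_right assms(2)]) (use assms in auto)
qed (use assms in auto)

lemma join_mono:
  assumes "x \<sqsubseteq> x'" "y \<sqsubseteq> y'" "x \<in> carrier L" "x' \<in> carrier L" "y \<in> carrier L" "y' \<in> carrier L"
  shows "x \<squnion> y \<sqsubseteq> x' \<squnion> y'"
proof (rule join_le)
  show "x \<sqsubseteq> x' \<squnion> y'"
    by (rule le_trans[OF assms(1) join_left]) (use assms in auto)
  show "y \<sqsubseteq> x' \<squnion> y'"
    by (rule le_trans[OF assms(2) join_right]) (use assms in auto)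
qed (use assms in auto)

text \<open>The binary join is the supremum of a pair, so this is the frame law for
  \<open>Y = {y, z}\<close>.\<close>

lemma meet_join_distrib:
  assumes "x \<in> carrier L" "y \<in> carrier L" "z \<in> carrier L"
  shows "x \<sqinter> (y \<squnion> z) = (x \<sqinter> y) \<squnion> (x \<sqinter> z)"
  using meet_sup_distrib[of x "{y, z}"] assms by (simp add: join_def)

end

lemma ord_semiring_frame_osr:
  fixes F :: "'a gorder"
  assumes "frame F"
  shows "ord_semiring (frame_osr F)"
proof -
  interpret frame F by fact
  have bot: "\<bottom>\<^bsub>F\<^esub> \<squnion>\<^bsub>F\<^esub> x = x" "\<bottom>\<^bsub>F\<^esub> \<sqinter>\<^bsub>F\<^esub> x = \<bottom>\<^bsub>F\<^esub>" if "x \<in> carrier F" for x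
    using bottom_join[OF that] bottom_meet[OF that] by (simp_all add: eq_is_equal)
  have top: "\<top>\<^bsub>F\<^esub> \<sqinter>\<^bsub>F\<^esub> x = x" if "x \<in> carrier F" for x
    using top_meet[OF that] by (simp add: eq_is_equal)
  have "abelian_monoid (frame_osr F)"
    by (rule abelian_monoidI) (simp_all add: join_assoc bot, rule join_comm)
  moreover have "comm_monoid (frame_osr F)"
    by (rule comm_monoidI) (simp_all add: meet_assoc top, rule meet_comm)
  moreover have "(x \<squnion>\<^bsub>F\<^esub> y) \<sqinter>\<^bsub>F\<^esub> z = (x \<sqinter>\<^bsub>F\<^esub> z) \<squnion>\<^bsub>F\<^esub> (y \<sqinter>\<^bsub>F\<^esub> z)"
    if "x \<in> carrier F" "y \<in> carrier F" "z \<in> carrier F" for x y z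
    \<comment> \<open>Commutativity with one argument fixed as \<open>z\<close> moves the common
      factor from left to right.\<close>
    using meet_join_distrib[of z x y] that by (simp only: meet_comm[of F z])
  moreover have "x \<sqinter>\<^bsub>F\<^esub> \<bottom>\<^bsub>F\<^esub> = \<bottom>\<^bsub>F\<^esub>" if "x \<in> carrier F" for x
    using bot(2)[OF that] by (simp only: meet_comm[of F x])
  ultimately show ?thesis
    by (intro ord_semiring.intro semiring.intro semiring_axioms.intro
        ord_semiring_axioms.intro comm_monoid.axioms(1))
      (auto simp: meet_join_distrib bot intro: le_trans meet_mono join_mono)
qed

section \<open>The frame of radical ideals\<close>

lemma
  assumes "radical_ideal A I"
  shows radical_ideal_subset: "I \<subseteq> carrier A"
    and radical_ideal_le: "\<lbrakk>y \<in> I; x \<preceq>\<^bsub>A\<^esub> y; x \<in> carrier A\<rbrakk> \<Longrightarrow> x \<in> I"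
    and radical_ideal_zero: "\<zero>\<^bsub>A\<^esub> \<in> I"
    and radical_ideal_add: "\<lbrakk>x \<in> I; y \<in> I\<rbrakk> \<Longrightarrow> x \<oplus>\<^bsub>A\<^esub> y \<in> I"
    and radical_ideal_mult: "\<lbrakk>x \<in> I \<or> y \<in> I; x \<in> carrier A; y \<in> carrier A\<rbrakk> \<Longrightarrow> x \<otimes>\<^bsub>A\<^esub> y \<in> I"
    and radical_ideal_pow: "\<lbrakk>x [^]\<^bsub>A\<^esub> (n::nat) \<in> I; x \<in> carrier A\<rbrakk> \<Longrightarrow> x \<in> I"
  using assms unfolding radical_ideal_def osr_ideal_def by blast+

lemma radical_idealI:
  assumes "I \<subseteq> carrier A"
    and "\<And>x y. \<lbrakk>y \<in> I; x \<preceq>\<^bsub>A\<^esub> y; x \<in> carrier A\<rbrakk> \<Longrightarrow> x \<in> I"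
    and "\<zero>\<^bsub>A\<^esub> \<in> I"
    and "\<And>x y. \<lbrakk>x \<in> I; y \<in> I\<rbrakk> \<Longrightarrow> x \<oplus>\<^bsub>A\<^esub> y \<in> I"
    and "\<And>x y. \<lbrakk>x \<in> I \<or> y \<in> I; x \<in> carrier A; y \<in> carrier A\<rbrakk> \<Longrightarrow> x \<otimes>\<^bsub>A\<^esub> y \<in> I"
    and "\<And>x n. \<lbrakk>x [^]\<^bsub>A\<^esub> (n::nat) \<in> I; x \<in> carrier A\<rbrakk> \<Longrightarrow> x \<in> I"
  shows "radical_ideal A I"
  unfolding radical_ideal_def osr_ideal_def
  by (intro conjI ballI allI impI; (rule assms; assumption))

context
  fixes A :: "'a ord_semiring" (structure)
  assumes osr: "ord_semiring A"
begin

interpretation ord_semiring A by (fact osr)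

lemma radical_ideal_square:
  assumes "radical_ideal A I" "x \<in> carrier A" "x \<otimes> x \<in> I"
  shows "x \<in> I"
proof -
  have "x [^] (2::nat) = x \<otimes> x" using assms(2) by (simp add: numeral_2_eq_2)
  with assms show ?thesis using radical_ideal_pow[of A I x 2] by simp
qed

text \<open>Absorption applied to \<open>\<one> \<otimes> x\<close>. It shows that
  \<open>Rad_unit\<close> sends \<open>\<one>\<close> to the top of \<open>Rad A\<close>.\<close>

lemma radical_ideal_one:
  assumes "radical_ideal A I" "\<one> \<in> I"
  shows "I = carrier A"
proof
  show "carrier A \<subseteq> I"
  proof
    fix x assume x: "x \<in> carrier A"
    have "\<one> \<otimes> x \<in> I" using assms x by (intro radical_ideal_mult) auto
    then show "x \<in> I" using x by simp
  qed
qed (rule radical_ideal_subset [OF assms(1)])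

lemma radical_ideal_carrier: "radical_ideal A (carrier A)"
  by (rule radical_idealI) auto

text \<open>The factor \<open>carrier A\<close> takes care of the empty family, since
  \<open>\<Inter>{}\<close> is \<open>UNIV\<close>.\<close>

lemma radical_ideal_Inter:
  assumes "\<And>I. I \<in> X \<Longrightarrow> radical_ideal A I"
  shows "radical_ideal A (carrier A \<inter> \<Inter>X)"
proof (rule radical_idealI)
  show "x \<in> carrier A \<inter> \<Inter>X" if "y \<in> carrier A \<inter> \<Inter>X" "x \<preceq> y" "x \<in> carrier A" for x y
    using that radical_ideal_le[OF assms] by blast
  show "\<zero> \<in> carrier A \<inter> \<Inter>X"
    using radical_ideal_zero[OF assms] by blast
  show "x \<oplus> y \<in> carrier A \<inter> \<Inter>X" if "x \<in> carrier A \<inter> \<Inter>X" "y \<in> carrier A \<inter> \<Inter>X" for x y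
    using that radical_ideal_add[OF assms] by blast
  show "x \<otimes> y \<in> carrier A \<inter> \<Inter>X"
    if "x \<in> carrier A \<inter> \<Inter>X \<or> y \<in> carrier A \<inter> \<Inter>X" "x \<in> carrier A" "y \<in> carrier A" for x y
    using that radical_ideal_mult[OF assms] by blast
  show "x \<in> carrier A \<inter> \<Inter>X" if "x [^] n \<in> carrier A \<inter> \<Inter>X" "x \<in> carrier A" for x and n :: nat
    using that radical_ideal_pow[OF assms] by blast
qed blast

lemma radical_ideal_Int:
  assumes "radical_ideal A I" "radical_ideal A J"
  shows "radical_ideal A (I \<inter> J)"
proof -
  have "carrier A \<inter> \<Inter>{I, J} = I \<inter> J" using radical_ideal_subset[OF assms(1)] by auto
  then show ?thesis using radical_ideal_Inter[of "{I, J}"] assms by auto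
qed

lemma radical_ideal_rad_gen:
  assumes "S \<subseteq> carrier A"
  shows "radical_ideal A (rad_gen A S)"
proof -
  \<comment> \<open>\<open>carrier A\<close> is itself one of the radical ideals containing
    \<open>S\<close>, so the extra factor changes nothing.\<close>
  have "rad_gen A S = carrier A \<inter> \<Inter>{I. radical_ideal A I \<and> S \<subseteq> I}"
    using radical_ideal_carrier assms by (auto simp: rad_gen_def)
  then show ?thesis using radical_ideal_Inter[of "{I. radical_ideal A I \<and> S \<subseteq> I}"] by simp
qed

text \<open>The ideal conditions pass from \<open>K\<close> by multiplying with a fixed
  \<open>z\<close>. For radicality, \<open>x [^] n \<otimes> z \<in> K\<close> puts a power of
  \<open>x \<otimes> z\<close> into \<open>K\<close>.\<close>

lemma radical_ideal_colon:
  assumes K: "radical_ideal A K" and S: "S \<subseteq> carrier A"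
  shows "radical_ideal A {x \<in> carrier A. \<forall>z\<in>S. x \<otimes> z \<in> K}"
proof (rule radical_idealI; (intro CollectI conjI ballI)?)
  fix x y z
  assume y: "y \<in> {x \<in> carrier A. \<forall>z\<in>S. x \<otimes> z \<in> K}" and xy: "x \<preceq> y"
    and x: "x \<in> carrier A" and "z \<in> S"
  then have z: "z \<in> carrier A" using S by auto
  have "x \<otimes> z \<preceq> y \<otimes> z" using mult_mono[OF xy ord_refl[OF z]] x y z by simp
  then show "x \<otimes> z \<in> K"
    by (rule radical_ideal_le[OF K, rotated]) (use x y z \<open>z \<in> S\<close> in auto)
next
  fix z assume "z \<in> S"
  then have "z \<in> carrier A" using S by auto
  then show "\<zero> \<otimes> z \<in> K" using radical_ideal_zero[OF K] by simp
next
  fix x y z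
  assume "x \<in> {x \<in> carrier A. \<forall>z\<in>S. x \<otimes> z \<in> K}" "y \<in> {x \<in> carrier A. \<forall>z\<in>S. x \<otimes> z \<in> K}" "z \<in> S"
  moreover from this have "z \<in> carrier A" using S by auto
  ultimately show "(x \<oplus> y) \<otimes> z \<in> K" by (simp add: l_distr radical_ideal_add[OF K])
next
  fix x y z
  assume xy: "x \<in> {x \<in> carrier A. \<forall>z\<in>S. x \<otimes> z \<in> K} \<or> y \<in> {x \<in> carrier A. \<forall>z\<in>S. x \<otimes> z \<in> K}"
    and c: "x \<in> carrier A" "y \<in> carrier A" and "z \<in> S"
  then have z: "z \<in> carrier A" using S by auto
  have "(x \<otimes> y) \<otimes> z = x \<otimes> (y \<otimes> z)" "(x \<otimes> y) \<otimes> z = y \<otimes> (x \<otimes> z)"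
    using c z by (simp_all add: m_ac)
  moreover have "x \<otimes> z \<in> K \<or> y \<otimes> z \<in> K" using xy \<open>z \<in> S\<close> by blast
  ultimately show "(x \<otimes> y) \<otimes> z \<in> K" using c z radical_ideal_mult[OF K] by (metis m_closed)
next
  fix x z and n :: nat
  assume n: "x [^] n \<in> {x \<in> carrier A. \<forall>z\<in>S. x \<otimes> z \<in> K}" and x: "x \<in> carrier A" and "z \<in> S"
  then have z: "z \<in> carrier A" using S by auto
  \<comment> \<open>The exponent is \<open>Suc n\<close> because \<open>n = 0\<close> is allowed: at
    least one factor \<open>z\<close> is needed to split off
    \<open>x [^] n \<otimes> z\<close>.\<close>
  have "(x \<otimes> z) [^] Suc n = (x [^] n \<otimes> z) \<otimes> (x \<otimes> z [^] n)"
    unfolding nat_pow_distrib[OF x z] using x z by (simp add: m_ac)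
  also have "\<dots> \<in> K" using x z n \<open>z \<in> S\<close> by (intro radical_ideal_mult[OF K]) auto
  finally show "x \<otimes> z \<in> K" using radical_ideal_pow[OF K] x z by blast
qed auto

end

section \<open>Generated radical ideals and the lattice structure of \<open>Rad A\<close>\<close>

lemma rad_gen_superset: "S \<subseteq> rad_gen A S"
  by (auto simp: rad_gen_def)

lemma rad_gen_least: "\<lbrakk>radical_ideal A I; S \<subseteq> I\<rbrakk> \<Longrightarrow> rad_gen A S \<subseteq> I"
  by (auto simp: rad_gen_def)

lemma rad_gen_radical_ideal: "radical_ideal A I \<Longrightarrow> rad_gen A I = I"
  by (simp add: rad_gen_superset rad_gen_least subset_antisym)

lemma Rad_simps [simp]:
  "carrier (Rad A) = {I. radical_ideal A I}"
  "eq (Rad A) = (=)"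
  "le (Rad A) = (\<subseteq>)"
  by (simp_all add: Rad_def)

context
  fixes A :: "'a ord_semiring" (structure)
  assumes osr: "ord_semiring A"
begin

interpretation ord_semiring A by (fact osr)

text \<open>One inclusion is absorption. For the other, two colon ideals replace first
  \<open>a\<close> and then \<open>b\<close> by a common element \<open>x\<close>, giving
  \<open>x \<otimes> x \<in> ?K\<close>. This makes \<open>Rad_unit\<close> multiplicative.\<close>

lemma rad_gen_mult:
  assumes a: "a \<in> carrier A" and b: "b \<in> carrier A"
  shows "rad_gen A {a \<otimes> b} = rad_gen A {a} \<inter> rad_gen A {b}"
proof
  let ?K = "rad_gen A {a \<otimes> b}"
  have K: "radical_ideal A ?K" by (rule radical_ideal_rad_gen[OF osr]) (simp add: a b)
  have Ra: "radical_ideal A (rad_gen A {a})" and Rb: "radical_ideal A (rad_gen A {b})"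
    using a b by (auto intro: radical_ideal_rad_gen[OF osr])
  have "a \<in> rad_gen A {a}" "b \<in> rad_gen A {b}"
    using rad_gen_superset[of "{a}" A] rad_gen_superset[of "{b}" A] by auto
  then show "?K \<subseteq> rad_gen A {a} \<inter> rad_gen A {b}"
    using a b Ra Rb by (intro rad_gen_least radical_ideal_Int[OF osr]) (auto intro: radical_ideal_mult)
  show "rad_gen A {a} \<inter> rad_gen A {b} \<subseteq> ?K"
  proof
    fix x assume x: "x \<in> rad_gen A {a} \<inter> rad_gen A {b}"
    then have xc: "x \<in> carrier A" using Ra radical_ideal_subset by blast
    have "rad_gen A {a} \<subseteq> {u \<in> carrier A. \<forall>v\<in>{b}. u \<otimes> v \<in> ?K}"
      using a b rad_gen_superset[of "{a \<otimes> b}" A]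
      by (intro rad_gen_least radical_ideal_colon[OF osr] K) auto
    then have "x \<otimes> b \<in> ?K" using x by auto
    \<comment> \<open>Now \<open>x\<close> is the fixed factor, and \<open>b\<close> belongs to the
      colon by commutativity.\<close>
    then have "rad_gen A {b} \<subseteq> {u \<in> carrier A. \<forall>v\<in>{x}. u \<otimes> v \<in> ?K}"
      using b xc by (intro rad_gen_least radical_ideal_colon[OF osr] K) (auto simp: m_comm)
    then have "x \<otimes> x \<in> ?K" using x by auto
    then show "x \<in> ?K" by (rule radical_ideal_square[OF osr K xc])
  qed
qed

lemma least_Upper_Rad:
  assumes "X \<subseteq> carrier (Rad A)"
  shows "least (Rad A) (rad_gen A (\<Union>X)) (Upper (Rad A) X)"
proof (rule least_UpperI)
  show "rad_gen A (\<Union>X) \<in> carrier (Rad A)"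
    using assms radical_ideal_subset[of A] by (auto intro!: radical_ideal_rad_gen[OF osr])
  show "rad_gen A (\<Union>X) \<sqsubseteq>\<^bsub>Rad A\<^esub> J" if "J \<in> Upper (Rad A) X" for J
    using that assms rad_gen_least[of A J "\<Union>X"] by (auto simp: Upper_def)
qed (use assms rad_gen_superset[of "\<Union>X" A] in auto)

lemma greatest_Lower_Rad:
  assumes "X \<subseteq> carrier (Rad A)"
  shows "greatest (Rad A) (carrier A \<inter> \<Inter>X) (Lower (Rad A) X)"
proof (rule greatest_LowerI)
  show "carrier A \<inter> \<Inter>X \<in> carrier (Rad A)"
    using assms by (auto intro!: radical_ideal_Inter[OF osr])
  show "J \<sqsubseteq>\<^bsub>Rad A\<^esub> carrier A \<inter> \<Inter>X" if "J \<in> Lower (Rad A) X" for J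
    using that assms radical_ideal_subset[of A J] by (auto simp: Lower_def)
qed (use assms in auto)

lemma complete_lattice_Rad: "complete_lattice (Rad A)"
proof
  show "\<exists>S. least (Rad A) S (Upper (Rad A) X)" if "X \<subseteq> carrier (Rad A)" for X
    using least_Upper_Rad[OF that] by blast
  show "\<exists>S. greatest (Rad A) S (Lower (Rad A) X)" if "X \<subseteq> carrier (Rad A)" for X
    using greatest_Lower_Rad[OF that] by blast
qed auto

interpretation Rad: complete_lattice "Rad A" by (rule complete_lattice_Rad)

lemma Rad_sup: "X \<subseteq> carrier (Rad A) \<Longrightarrow> \<Squnion>\<^bsub>Rad A\<^esub>X = rad_gen A (\<Union>X)"
  by (rule Rad.least_unique[OF Rad.sup_lub least_Upper_Rad])

text \<open>For a radical ideal \<open>S\<close> this writes \<open>S\<close> as a join of principal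
  ones, so a join-preserving map on \<open>Rad A\<close> is determined by its values on
  those.\<close>

lemma Rad_sup_principal:
  assumes S: "S \<subseteq> carrier A"
  shows "\<Squnion>\<^bsub>Rad A\<^esub>((\<lambda>x. rad_gen A {x}) ` S) = rad_gen A S"
proof -
  have "(\<lambda>x. rad_gen A {x}) ` S \<subseteq> carrier (Rad A)"
    using S by (auto intro!: radical_ideal_rad_gen[OF osr])
  then have "\<Squnion>\<^bsub>Rad A\<^esub>((\<lambda>x. rad_gen A {x}) ` S) = rad_gen A (\<Union>x\<in>S. rad_gen A {x})"
    by (rule Rad_sup)
  also have "\<dots> = rad_gen A S"
  proof
    have K: "radical_ideal A (rad_gen A S)" by (rule radical_ideal_rad_gen[OF osr S])
    have U: "(\<Union>x\<in>S. rad_gen A {x}) \<subseteq> rad_gen A S"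
      using rad_gen_superset[of S A] by (intro UN_least rad_gen_least K) auto
    then show "rad_gen A (\<Union>x\<in>S. rad_gen A {x}) \<subseteq> rad_gen A S"
      by (rule rad_gen_least[OF K])
    have "radical_ideal A (rad_gen A (\<Union>x\<in>S. rad_gen A {x}))"
      by (rule radical_ideal_rad_gen[OF osr subset_trans[OF U radical_ideal_subset[OF K]]])
    moreover have "S \<subseteq> (\<Union>x\<in>S. rad_gen A {x})"
      using rad_gen_superset[of "{_}" A] by blast
    ultimately show "rad_gen A S \<subseteq> rad_gen A (\<Union>x\<in>S. rad_gen A {x})"
      by (intro rad_gen_least subset_trans[OF _ rad_gen_superset])
  qed
  finally show ?thesis .
qed

lemma Rad_meet:
  assumes "radical_ideal A I" "radical_ideal A J"
  shows "I \<sqinter>\<^bsub>Rad A\<^esub> J = I \<inter> J"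
proof -
  have "I \<sqinter>\<^bsub>Rad A\<^esub> J = carrier A \<inter> \<Inter>{I, J}"
    unfolding meet_def
    by (rule Rad.greatest_unique[OF Rad.inf_glb greatest_Lower_Rad]) (use assms in auto)
  also have "\<dots> = I \<inter> J" using radical_ideal_subset[OF assms(1)] by auto
  finally show ?thesis .
qed

lemma Rad_top: "\<top>\<^bsub>Rad A\<^esub> = carrier A"
  using Rad.top_closed Rad.top_higher[of "carrier A"] radical_ideal_carrier[OF osr]
  by (auto dest: radical_ideal_subset)

text \<open>The colon of \<open>?K\<close> by \<open>I\<close> contains every
  \<open>J \<in> X\<close>, because \<open>x \<otimes> y\<close> lies in \<open>I \<inter> J\<close>
  for \<open>x \<in> J\<close> and \<open>y \<in> I\<close>. Hence it contains
  \<open>rad_gen A (\<Union>X)\<close>.\<close>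

lemma frame_Rad: "frame (Rad A)"
proof
  fix I X assume I: "I \<in> carrier (Rad A)" and X: "X \<subseteq> carrier (Rad A)"
  let ?K = "rad_gen A (\<Union>J\<in>X. I \<inter> J)"
  have Ir: "radical_ideal A I" and Xr: "\<And>J. J \<in> X \<Longrightarrow> radical_ideal A J"
    using I X by auto
  have Is: "I \<subseteq> carrier A" and Xs: "\<Union>X \<subseteq> carrier A"
    using Ir Xr by (auto dest: radical_ideal_subset)
  have K: "radical_ideal A ?K" using Is by (intro radical_ideal_rad_gen[OF osr]) auto
  have "I \<inter> rad_gen A (\<Union>X) = ?K"
  proof
    have "rad_gen A (\<Union>X) \<subseteq> {x \<in> carrier A. \<forall>y\<in>I. x \<otimes> y \<in> ?K}"
    proof (intro rad_gen_least radical_ideal_colon[OF osr] K Is subsetI CollectI conjI ballI)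
      fix x y assume "x \<in> \<Union>X" and y: "y \<in> I"
      then obtain J where J: "J \<in> X" "x \<in> J" by auto
      then have "x \<in> carrier A" "y \<in> carrier A" using Is Xs y by auto
      then have "x \<otimes> y \<in> I \<inter> J"
        using Ir Xr[OF J(1)] J(2) y by (auto intro: radical_ideal_mult)
      then show "x \<otimes> y \<in> ?K" using J(1) rad_gen_superset[of "\<Union>J\<in>X. I \<inter> J" A] by blast
    qed (use Xs in auto)
    \<comment> \<open>An element \<open>x\<close> of both sets may be multiplied by itself in the
      colon condition, so \<open>x \<otimes> x \<in> ?K\<close>.\<close>
    then show "I \<inter> rad_gen A (\<Union>X) \<subseteq> ?K"
      using Is radical_ideal_square[OF osr K] by blast
    have "radical_ideal A (I \<inter> rad_gen A (\<Union>X))"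
      by (intro radical_ideal_Int[OF osr] radical_ideal_rad_gen[OF osr] Ir Xs)
    then show "?K \<subseteq> I \<inter> rad_gen A (\<Union>X)"
      using rad_gen_superset[of "\<Union>X" A] by (intro rad_gen_least) auto
  qed
  moreover have "(\<lambda>J. I \<sqinter>\<^bsub>Rad A\<^esub> J) ` X = (\<lambda>J. I \<inter> J) ` X"
    using Ir Xr by (intro image_cong refl Rad_meet)
  moreover have "(\<lambda>J. I \<inter> J) ` X \<subseteq> carrier (Rad A)"
    using Ir Xr by (auto intro: radical_ideal_Int[OF osr])
  moreover have "radical_ideal A (rad_gen A (\<Union>X))"
    by (rule radical_ideal_rad_gen[OF osr Xs])
  ultimately show "I \<sqinter>\<^bsub>Rad A\<^esub> \<Squnion>\<^bsub>Rad A\<^esub>X = \<Squnion>\<^bsub>Rad A\<^esub>((\<lambda>J. I \<sqinter>\<^bsub>Rad A\<^esub> J) ` X)"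
    using Ir by (simp add: Rad_sup[OF X] Rad_sup Rad_meet)
qed

text \<open>By minimality of generated ideals, each required inclusion reduces to membership of the
  generator in the larger ideal; products are handled by \<open>rad_gen_mult\<close>.\<close>

lemma Rad_unit_OSR_hom: "Rad_unit A \<in> OSR_hom A (frame_osr (Rad A))"
proof -
  have rad: "radical_ideal A (rad_gen A {x})" if "x \<in> carrier A" for x
    using that by (intro radical_ideal_rad_gen[OF osr]) auto
  have self: "x \<in> rad_gen A {x}" for x using rad_gen_superset[of "{x}" A] by auto
  have mono: "rad_gen A {x} \<subseteq> rad_gen A {y}"
    if "x \<in> carrier A" "y \<in> carrier A" "x \<preceq> y" for x y
    using rad[OF that(2)] self[of y] that
    by (intro rad_gen_least) (auto intro: radical_ideal_le)
  have bot: "rad_gen A {\<zero>} \<subseteq> \<bottom>\<^bsub>Rad A\<^esub>"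
    using Rad.bottom_closed by (intro rad_gen_least) (auto intro: radical_ideal_zero)
  have one: "rad_gen A {\<one>} = carrier A"
    by (rule radical_ideal_one[OF osr rad self]) simp
  have add: "rad_gen A {x \<oplus> y} \<subseteq> rad_gen A {x} \<squnion>\<^bsub>Rad A\<^esub> rad_gen A {y}"
    if x: "x \<in> carrier A" and y: "y \<in> carrier A" for x y
  proof -
    let ?J = "rad_gen A {x} \<squnion>\<^bsub>Rad A\<^esub> rad_gen A {y}"
    have J: "radical_ideal A ?J" "rad_gen A {x} \<subseteq> ?J" "rad_gen A {y} \<subseteq> ?J"
      using Rad.join_closed[of "rad_gen A {x}" "rad_gen A {y}"]
        Rad.join_left[of "rad_gen A {x}" "rad_gen A {y}"]
        Rad.join_right[of "rad_gen A {x}" "rad_gen A {y}"] rad x y by auto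
    then have "x \<in> ?J" "y \<in> ?J" using self[of x] self[of y] by auto
    then show ?thesis using J(1) by (intro rad_gen_least) (auto intro: radical_ideal_add)
  qed
  show ?thesis
    using rad mono bot one add by (auto simp: OSR_hom_def Rad_unit_def Rad_top Rad_meet rad_gen_mult)
qed

end

section \<open>The adjunction\<close>

context
  fixes A :: "'a ord_semiring" (structure) and B :: "'b ord_semiring"
  assumes osr: "ord_semiring A" "ord_semiring B"
begin

interpretation ord_semiring A by (fact osr)
interpretation B: ord_semiring B by (fact osr)

context
  fixes f
  assumes f: "f \<in> OSR_hom A B"
begin

lemma OSR_hom_closed: "x \<in> carrier A \<Longrightarrow> f x \<in> carrier B"
  using f by (auto simp: OSR_hom_def)

lemma OSR_hom_image: "I \<subseteq> carrier A \<Longrightarrow> f ` I \<subseteq> carrier B"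
  using OSR_hom_closed by auto

lemma OSR_hom_pow: "x \<in> carrier A \<Longrightarrow> f (x [^] (n::nat)) = f x [^]\<^bsub>B\<^esub> n"
  using f by (induction n) (auto simp: OSR_hom_def)

text \<open>Downward closure of \<open>K\<close> absorbs the inequalities for \<open>\<zero>\<close>
  and \<open>\<oplus>\<close>, so subadditivity suffices. Absorption and radicality use that
  products, and hence powers, are preserved exactly.\<close>

lemma radical_ideal_vimage:
  assumes K: "radical_ideal B K"
  shows "radical_ideal A {x \<in> carrier A. f x \<in> K}"
proof (rule radical_idealI; (intro CollectI conjI)?)
  fix x y assume "y \<in> {x \<in> carrier A. f x \<in> K}" "x \<preceq> y" "x \<in> carrier A"
  then show "f x \<in> K"
    using f OSR_hom_closed by (auto simp: OSR_hom_def intro: radical_ideal_le[OF K, of "f y"])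
next
  show "f \<zero> \<in> K"
    by (rule radical_ideal_le[OF K radical_ideal_zero[OF K]])
      (use f in \<open>auto simp: OSR_hom_def\<close>)
next
  fix x y assume xy: "x \<in> {x \<in> carrier A. f x \<in> K}" "y \<in> {x \<in> carrier A. f x \<in> K}"
  then have "f x \<oplus>\<^bsub>B\<^esub> f y \<in> K" by (auto intro: radical_ideal_add[OF K])
  then show "f (x \<oplus> y) \<in> K"
    by (rule radical_ideal_le[OF K]) (use f xy in \<open>auto simp: OSR_hom_def\<close>)
next
  fix x y
  assume "x \<in> {x \<in> carrier A. f x \<in> K} \<or> y \<in> {x \<in> carrier A. f x \<in> K}"
    and c: "x \<in> carrier A" "y \<in> carrier A"
  then have "f x \<otimes>\<^bsub>B\<^esub> f y \<in> K"
    using OSR_hom_closed by (intro radical_ideal_mult[OF K]) auto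
  then show "f (x \<otimes> y) \<in> K" using f c by (auto simp: OSR_hom_def)
next
  fix x and n :: nat assume "x [^] n \<in> {x \<in> carrier A. f x \<in> K}" and x: "x \<in> carrier A"
  then have "f x [^]\<^bsub>B\<^esub> n \<in> K" by (simp add: OSR_hom_pow)
  then show "f x \<in> K" using OSR_hom_closed[OF x] by (rule radical_ideal_pow[OF K])
qed auto

lemma rad_gen_image_rad_gen:
  assumes S: "S \<subseteq> carrier A"
  shows "rad_gen B (f ` rad_gen A S) = rad_gen B (f ` S)"
proof
  have K: "radical_ideal B (rad_gen B (f ` S))"
    by (intro radical_ideal_rad_gen[OF osr(2)] OSR_hom_image S)
  have "rad_gen A S \<subseteq> {x \<in> carrier A. f x \<in> rad_gen B (f ` S)}"
    using S rad_gen_superset[of "f ` S" B] by (intro rad_gen_least radical_ideal_vimage K) auto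
  then show "rad_gen B (f ` rad_gen A S) \<subseteq> rad_gen B (f ` S)"
    by (intro rad_gen_least K) auto
  have "radical_ideal B (rad_gen B (f ` rad_gen A S))"
    by (intro radical_ideal_rad_gen[OF osr(2)] OSR_hom_image radical_ideal_subset
        radical_ideal_rad_gen[OF osr(1)] S)
  then show "rad_gen B (f ` S) \<subseteq> rad_gen B (f ` rad_gen A S)"
    using rad_gen_superset[of S A] rad_gen_superset[of "f ` rad_gen A S" B]
    by (intro rad_gen_least) auto
qed

text \<open>Naturality of the unit, stated on elements.\<close>

lemma Rad_map_rad_gen: "x \<in> carrier A \<Longrightarrow> Rad_map A B f (rad_gen A {x}) = rad_gen B {f x}"
  using radical_ideal_rad_gen[OF osr(1), of "{x}"] rad_gen_image_rad_gen[of "{x}"]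
  by (simp add: Rad_map_def)

end

end

lemma Rad_map_id:
  assumes "ord_semiring A"
  shows "Rad_map A A (id_mor A) = id_mor (Rad A)"
proof -
  have "(\<lambda>x\<in>carrier A. x) ` I = I" if "radical_ideal A I" for I
    using radical_ideal_subset[OF that] by force
  then show ?thesis
    by (auto simp: Rad_map_def id_mor_def rad_gen_radical_ideal intro!: restrict_ext)
qed

lemma Rad_map_comp:
  assumes osr: "ord_semiring A" "ord_semiring B" "ord_semiring C"
    and f: "f \<in> OSR_hom A B" and g: "g \<in> OSR_hom B C"
  shows "Rad_map A C (comp_mor A g f) = comp_mor (Rad A) (Rad_map B C g) (Rad_map A B f)"
proof
  fix I
  show "Rad_map A C (comp_mor A g f) I = comp_mor (Rad A) (Rad_map B C g) (Rad_map A B f) I"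
  proof (cases "radical_ideal A I")
    case True
    then have I: "I \<subseteq> carrier A" by (rule radical_ideal_subset)
    have fI: "f ` I \<subseteq> carrier B" by (rule OSR_hom_image[OF osr(1,2) f I])
    have "comp_mor A g f ` I = g ` f ` I"
      using I by (force simp: comp_mor_def compose_def)
    moreover have "radical_ideal B (rad_gen B (f ` I))"
      by (rule radical_ideal_rad_gen[OF osr(2) fI])
    ultimately show ?thesis
      using True rad_gen_image_rad_gen[OF osr(2,3) g fI]
      by (simp add: Rad_map_def comp_mor_def compose_def)
  \<comment> \<open>Outside \<open>carrier (Rad A)\<close> both sides take the value
    \<open>undefined\<close>.\<close>
  qed (simp add: Rad_map_def comp_mor_def compose_def)
qed

section \<open>Frame homomorphisms as subadditive morphisms, and principal down-sets of a
  frame\<close>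

lemma Frm_hom_OSR_hom:
  assumes "frame F" "frame G" and h: "h \<in> Frm_hom F G"
  shows "h \<in> OSR_hom (frame_osr F) (frame_osr G)"
proof -
  interpret F: frame F by fact
  interpret G: frame G by fact
  have cl: "h x \<in> carrier G" if "x \<in> carrier F" for x
    using h that by (auto simp: Frm_hom_def)
  have sup: "h (\<Squnion>\<^bsub>F\<^esub>Y) = \<Squnion>\<^bsub>G\<^esub>(h ` Y)" if "Y \<subseteq> carrier F" for Y
    using h that by (auto simp: Frm_hom_def)
  have meet: "h (x \<sqinter>\<^bsub>F\<^esub> y) = h x \<sqinter>\<^bsub>G\<^esub> h y" if "x \<in> carrier F" "y \<in> carrier F" for x y
    using h that by (auto simp: Frm_hom_def)
  have mono: "h x \<sqsubseteq>\<^bsub>G\<^esub> h y" if "x \<in> carrier F" "y \<in> carrier F" "x \<sqsubseteq>\<^bsub>F\<^esub> y" for x y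
  proof -
    \<comment> \<open>Despite its name, \<open>le_iff_join\<close> expresses
      \<open>x \<sqsubseteq> y\<close> through the meet, as
      \<open>x = x \<sqinter> y\<close>.\<close>
    have "h x = h x \<sqinter>\<^bsub>G\<^esub> h y" using that F.le_iff_join[of x y] meet[of x y] by simp
    then show ?thesis using G.le_iff_join[of "h x" "h y"] cl that by simp
  qed
  have join: "h (x \<squnion>\<^bsub>F\<^esub> y) = h x \<squnion>\<^bsub>G\<^esub> h y" if "x \<in> carrier F" "y \<in> carrier F" for x y
    using sup[of "{x, y}"] that by (simp add: join_def)
  \<comment> \<open>Bottom is the empty join, so preservation of joins covers it.\<close>
  have "\<bottom>\<^bsub>F\<^esub> = \<Squnion>\<^bsub>F\<^esub>{}" using F.weak_sup_empty by (simp add: F.eq_is_equal)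
  then have "h \<bottom>\<^bsub>F\<^esub> = \<bottom>\<^bsub>G\<^esub>" using sup[of "{}"] G.weak_sup_empty by (simp add: G.eq_is_equal)
  then show ?thesis
    using h cl mono join by (auto simp: OSR_hom_def Frm_hom_def)
qed

text \<open>Radicality holds because multiplication is the meet: \<open>x\<close> lies below each of
  its powers, including the zeroth, which is the top.\<close>

lemma radical_ideal_frame_downset:
  assumes "frame F" and u: "u \<in> carrier F"
  shows "radical_ideal (frame_osr F) {x \<in> carrier F. x \<sqsubseteq>\<^bsub>F\<^esub> u}"
proof -
  interpret F: frame F by fact
  have pow: "x \<sqsubseteq>\<^bsub>F\<^esub> x [^]\<^bsub>frame_osr F\<^esub> n" "x [^]\<^bsub>frame_osr F\<^esub> n \<in> carrier F"
    if "x \<in> carrier F" for x and n :: nat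
    using that by (induction n) (auto intro: F.meet_le simp: nat_pow_def)
  have le: "x \<sqsubseteq>\<^bsub>F\<^esub> u" if "x [^]\<^bsub>frame_osr F\<^esub> n \<sqsubseteq>\<^bsub>F\<^esub> u" "x \<in> carrier F" for x and n :: nat
    using F.le_trans[OF pow(1) that(1)] that(2) u pow(2) by auto
  show ?thesis
    by (rule radical_idealI)
      (use u le in \<open>auto intro: F.le_trans F.join_le F.le_trans[OF F.meet_left] F.le_trans[OF F.meet_right]\<close>)
qed

section \<open>Extension of a subadditive morphism into a frame along the unit\<close>

context
  fixes A :: "'a ord_semiring" (structure) and F :: "'u gorder"
  assumes osr: "ord_semiring A" and frame: "frame F"
begin

interpretation ord_semiring A by (fact osr)
interpretation F: frame F by (fact frame)

lemma Rad_unit_radical_ideal: "x \<in> carrier A \<Longrightarrow> radical_ideal A (rad_gen A {x})"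
  by (intro radical_ideal_rad_gen[OF osr]) auto

context
  fixes f
  assumes f: "f \<in> OSR_hom A (frame_osr F)"
begin

lemma frame_OSR_hom_image: "S \<subseteq> carrier A \<Longrightarrow> f ` S \<subseteq> carrier F"
  using f by (auto simp: OSR_hom_def)

lemma sup_image_rad_gen:
  assumes S: "S \<subseteq> carrier A"
  shows "\<Squnion>\<^bsub>F\<^esub>(f ` rad_gen A S) = \<Squnion>\<^bsub>F\<^esub>(f ` S)"
proof (rule F.sup_eqI)
  have rad: "radical_ideal A (rad_gen A S)" by (rule radical_ideal_rad_gen[OF osr S])
  show rc: "f ` rad_gen A S \<subseteq> carrier F"
    by (intro frame_OSR_hom_image radical_ideal_subset rad)
  show u: "\<Squnion>\<^bsub>F\<^esub>(f ` S) \<in> carrier F"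
    by (intro F.sup_closed frame_OSR_hom_image S)
  have "rad_gen A S \<subseteq> {x \<in> carrier A. f x \<in> {y \<in> carrier F. y \<sqsubseteq>\<^bsub>F\<^esub> \<Squnion>\<^bsub>F\<^esub>(f ` S)}}"
  proof (rule rad_gen_least)
    show "radical_ideal A {x \<in> carrier A. f x \<in> {y \<in> carrier F. y \<sqsubseteq>\<^bsub>F\<^esub> \<Squnion>\<^bsub>F\<^esub>(f ` S)}}"
      by (intro radical_ideal_vimage[OF osr ord_semiring_frame_osr[OF frame] f]
          radical_ideal_frame_downset frame u)
    show "S \<subseteq> {x \<in> carrier A. f x \<in> {y \<in> carrier F. y \<sqsubseteq>\<^bsub>F\<^esub> \<Squnion>\<^bsub>F\<^esub>(f ` S)}}"
      using S frame_OSR_hom_image[OF S] by (auto intro: F.sup_upper)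
  qed
  then show "y \<sqsubseteq>\<^bsub>F\<^esub> \<Squnion>\<^bsub>F\<^esub>(f ` S)" if "y \<in> f ` rad_gen A S" for y
    using that by auto
  show "\<Squnion>\<^bsub>F\<^esub>(f ` S) \<sqsubseteq>\<^bsub>F\<^esub> z"
    if "z \<in> carrier F" "\<And>y. y \<in> f ` rad_gen A S \<Longrightarrow> y \<sqsubseteq>\<^bsub>F\<^esub> z" for z
    using that rad_gen_superset[of S A] by (intro F.sup_least frame_OSR_hom_image S) auto
qed

text \<open>For joins, \<open>sup_image_rad_gen\<close> removes the generated ideal and leaves a
  supremum over a union. For meets, the frame law of \<open>F\<close> is applied in each argument,
  reducing to \<open>f x \<sqinter> f y = f (x \<otimes> y)\<close> with
  \<open>x \<otimes> y \<in> I \<inter> J\<close>.\<close>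

lemma extension_Frm_hom:
  "(\<lambda>I\<in>carrier (Rad A). \<Squnion>\<^bsub>F\<^esub>(f ` I)) \<in> Frm_hom (Rad A) F" (is "?g \<in> _")
proof -
  have im: "f ` I \<subseteq> carrier F" if "radical_ideal A I" for I
    by (intro frame_OSR_hom_image radical_ideal_subset that)
  have closed: "\<Squnion>\<^bsub>F\<^esub>(f ` I) \<in> carrier F" if "radical_ideal A I" for I
    by (intro F.sup_closed im that)
  have sup: "?g (\<Squnion>\<^bsub>Rad A\<^esub>X) = \<Squnion>\<^bsub>F\<^esub>(?g ` X)" if X: "X \<subseteq> carrier (Rad A)" for X
  proof -
    have Xr: "radical_ideal A I" if "I \<in> X" for I using X that by auto
    then have Xs: "\<Union>X \<subseteq> carrier A" using radical_ideal_subset by blast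
    have "?g (\<Squnion>\<^bsub>Rad A\<^esub>X) = \<Squnion>\<^bsub>F\<^esub>(f ` rad_gen A (\<Union>X))"
      using radical_ideal_rad_gen[OF osr Xs] by (simp add: Rad_sup[OF osr X])
    also have "\<dots> = \<Squnion>\<^bsub>F\<^esub>(f ` \<Union>X)" by (rule sup_image_rad_gen[OF Xs])
    also have "\<dots> = \<Squnion>\<^bsub>F\<^esub>((\<lambda>I. \<Squnion>\<^bsub>F\<^esub>(f ` I)) ` X)"
    proof (rule F.sup_eqI)
      show "f ` \<Union>X \<subseteq> carrier F" by (rule frame_OSR_hom_image[OF Xs])
      have SX: "(\<lambda>I. \<Squnion>\<^bsub>F\<^esub>(f ` I)) ` X \<subseteq> carrier F" using closed Xr by auto
      then show scl: "\<Squnion>\<^bsub>F\<^esub>((\<lambda>I. \<Squnion>\<^bsub>F\<^esub>(f ` I)) ` X) \<in> carrier F" by (rule F.sup_closed)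
      show "y \<sqsubseteq>\<^bsub>F\<^esub> \<Squnion>\<^bsub>F\<^esub>((\<lambda>I. \<Squnion>\<^bsub>F\<^esub>(f ` I)) ` X)" if y: "y \<in> f ` \<Union>X" for y
      proof -
        obtain I where I: "I \<in> X" "y \<in> f ` I" using y by auto
        show ?thesis
        proof (rule F.le_trans)
          show "y \<sqsubseteq>\<^bsub>F\<^esub> \<Squnion>\<^bsub>F\<^esub>(f ` I)" by (rule F.sup_upper[OF im[OF Xr[OF I(1)]] I(2)])
          show "\<Squnion>\<^bsub>F\<^esub>(f ` I) \<sqsubseteq>\<^bsub>F\<^esub> \<Squnion>\<^bsub>F\<^esub>((\<lambda>I. \<Squnion>\<^bsub>F\<^esub>(f ` I)) ` X)"
            by (rule F.sup_upper[OF SX]) (use I in auto)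
        qed (use I im[OF Xr[OF I(1)]] closed[OF Xr[OF I(1)]] scl in auto)
      qed
      show "\<Squnion>\<^bsub>F\<^esub>((\<lambda>I. \<Squnion>\<^bsub>F\<^esub>(f ` I)) ` X) \<sqsubseteq>\<^bsub>F\<^esub> z"
        if z: "z \<in> carrier F" "\<And>y. y \<in> f ` \<Union>X \<Longrightarrow> y \<sqsubseteq>\<^bsub>F\<^esub> z" for z
      proof (rule F.sup_least[OF SX z(1)])
        fix y assume "y \<in> (\<lambda>I. \<Squnion>\<^bsub>F\<^esub>(f ` I)) ` X"
        then obtain I where I: "I \<in> X" "y = \<Squnion>\<^bsub>F\<^esub>(f ` I)" by auto
        show "y \<sqsubseteq>\<^bsub>F\<^esub> z" unfolding I(2)
          by (rule F.sup_least[OF im[OF Xr[OF I(1)]] z(1) z(2)]) (use I in auto)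
      qed
    qed
    also have "(\<lambda>I. \<Squnion>\<^bsub>F\<^esub>(f ` I)) ` X = ?g ` X" using Xr by (intro image_cong) auto
    finally show ?thesis .
  qed
  \<comment> \<open>The top of \<open>Rad A\<close> is \<open>carrier A\<close>, which contains
    \<open>\<one>\<close>, so \<open>\<top>\<close> is among the values joined.\<close>
  have "f \<one> = \<top>\<^bsub>F\<^esub>" using f by (simp add: OSR_hom_def)
  then have "\<top>\<^bsub>F\<^esub> \<sqsubseteq>\<^bsub>F\<^esub> \<Squnion>\<^bsub>F\<^esub>(f ` carrier A)"
    using im[OF radical_ideal_carrier[OF osr]] by (intro F.sup_upper) (auto intro: image_eqI[of _ _ \<one>])
  then have top: "\<Squnion>\<^bsub>F\<^esub>(f ` carrier A) = \<top>\<^bsub>F\<^esub>"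
    using closed[OF radical_ideal_carrier[OF osr]] by (intro F.le_antisym) auto
  have meet: "\<Squnion>\<^bsub>F\<^esub>(f ` (I \<inter> J)) = \<Squnion>\<^bsub>F\<^esub>(f ` I) \<sqinter>\<^bsub>F\<^esub> \<Squnion>\<^bsub>F\<^esub>(f ` J)" (is "?u = ?v \<sqinter>\<^bsub>F\<^esub> ?w")
    if I: "radical_ideal A I" and J: "radical_ideal A J" for I J
  proof (rule F.le_antisym)
    have IJ: "radical_ideal A (I \<inter> J)" by (rule radical_ideal_Int[OF osr I J])
    show uc: "?u \<in> carrier F" and vwc: "?v \<sqinter>\<^bsub>F\<^esub> ?w \<in> carrier F"
      using closed[OF I] closed[OF J] closed[OF IJ] by auto
    show "?u \<sqsubseteq>\<^bsub>F\<^esub> ?v \<sqinter>\<^bsub>F\<^esub> ?w"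
    proof (rule F.meet_le)
      show "?u \<sqsubseteq>\<^bsub>F\<^esub> ?v"
        by (rule F.sup_least[OF im[OF IJ] closed[OF I]]) (auto intro: F.sup_upper[OF im[OF I]])
      show "?u \<sqsubseteq>\<^bsub>F\<^esub> ?w"
        by (rule F.sup_least[OF im[OF IJ] closed[OF J]]) (auto intro: F.sup_upper[OF im[OF J]])
    qed (use closed I J IJ in auto)
    have le1: "f x \<sqinter>\<^bsub>F\<^esub> f y \<sqsubseteq>\<^bsub>F\<^esub> ?u" if x: "x \<in> I" and y: "y \<in> J" for x y
    proof -
      have c: "x \<in> carrier A" "y \<in> carrier A"
        using x y radical_ideal_subset[OF I] radical_ideal_subset[OF J] by auto
      have "f x \<sqinter>\<^bsub>F\<^esub> f y = f (x \<otimes> y)" using f c by (simp add: OSR_hom_def)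
      moreover have "x \<otimes> y \<in> I \<inter> J"
        using x y c by (auto intro: radical_ideal_mult[OF I] radical_ideal_mult[OF J])
      ultimately show ?thesis using F.sup_upper[OF im[OF IJ]] by auto
    qed
    have le2: "f x \<sqinter>\<^bsub>F\<^esub> ?w \<sqsubseteq>\<^bsub>F\<^esub> ?u" if x: "x \<in> I" for x
    proof -
      have c: "f x \<in> carrier F" using x im[OF I] by auto
      show ?thesis
        unfolding F.meet_sup_distrib[OF c im[OF J]]
        by (rule F.sup_least[OF _ uc]) (use c im[OF J] le1[OF x] in auto)
    qed
    \<comment> \<open>The frame law distributes over the right argument, so the two joins are
      swapped here and swapped back at the end.\<close>
    have "?w \<sqinter>\<^bsub>F\<^esub> ?v \<sqsubseteq>\<^bsub>F\<^esub> ?u"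
      unfolding F.meet_sup_distrib[OF closed[OF J] im[OF I]]
    proof (rule F.sup_least[OF _ uc])
      show "(\<lambda>y. ?w \<sqinter>\<^bsub>F\<^esub> y) ` f ` I \<subseteq> carrier F" using closed[OF J] im[OF I] by auto
      fix z assume "z \<in> (\<lambda>y. ?w \<sqinter>\<^bsub>F\<^esub> y) ` f ` I"
      then obtain x where "x \<in> I" "z = ?w \<sqinter>\<^bsub>F\<^esub> f x" by auto
      then show "z \<sqsubseteq>\<^bsub>F\<^esub> ?u" using le2[of x] meet_comm[of F ?w "f x"] by simp
    qed
    then show "?v \<sqinter>\<^bsub>F\<^esub> ?w \<sqsubseteq>\<^bsub>F\<^esub> ?u" by (simp only: meet_comm[of F ?v])
  qed
  show ?thesis
    unfolding Frm_hom_def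
  proof (intro CollectI conjI allI impI ballI)
    show "?g \<in> carrier (Rad A) \<rightarrow>\<^sub>E carrier F" using closed by auto
    show "?g \<top>\<^bsub>Rad A\<^esub> = \<top>\<^bsub>F\<^esub>" by (simp add: Rad_top[OF osr] radical_ideal_carrier[OF osr] top)
    show "?g (I \<sqinter>\<^bsub>Rad A\<^esub> J) = ?g I \<sqinter>\<^bsub>F\<^esub> ?g J" if "I \<in> carrier (Rad A)" "J \<in> carrier (Rad A)" for I J
      using that by (simp add: Rad_meet[OF osr] meet radical_ideal_Int[OF osr])
  qed (rule sup)
qed

text \<open>On the carrier this is \<open>sup_image_rad_gen\<close> for \<open>S = {x}\<close>;
  elsewhere both sides are \<open>undefined\<close>.\<close>

lemma Rad_transpose_extension:
  "Rad_transpose A (\<lambda>I\<in>carrier (Rad A). \<Squnion>\<^bsub>F\<^esub>(f ` I)) = f"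
proof
  fix x
  show "Rad_transpose A (\<lambda>I\<in>carrier (Rad A). \<Squnion>\<^bsub>F\<^esub>(f ` I)) x = f x"
  proof (cases "x \<in> carrier A")
    case True
    then have "\<Squnion>\<^bsub>F\<^esub>(f ` rad_gen A {x}) = f x"
      using frame_OSR_hom_image[of "{x}"] by (simp add: sup_image_rad_gen)
    then show ?thesis
      using True by (simp add: Rad_transpose_def comp_mor_def compose_def Rad_unit_def
          Rad_unit_radical_ideal)
  next
    case False
    then show ?thesis
      using f by (auto simp: Rad_transpose_def comp_mor_def compose_def OSR_hom_def)
  qed
qed

end

text \<open>\<open>Rad_sup_principal\<close> decomposes \<open>I\<close>, and \<open>g\<close>
  preserves that join. This is the uniqueness half of the universal property.\<close>

lemma Frm_hom_Rad_apply:
  assumes g: "g \<in> Frm_hom (Rad A) F" and I: "radical_ideal A I"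
  shows "g I = \<Squnion>\<^bsub>F\<^esub>(Rad_transpose A g ` I)"
proof -
  have Is: "I \<subseteq> carrier A" by (rule radical_ideal_subset[OF I])
  have X: "(\<lambda>x. rad_gen A {x}) ` I \<subseteq> carrier (Rad A)" using Is Rad_unit_radical_ideal by auto
  have "g I = g (\<Squnion>\<^bsub>Rad A\<^esub>((\<lambda>x. rad_gen A {x}) ` I))"
    by (simp add: Rad_sup_principal[OF osr Is] rad_gen_radical_ideal[OF I])
  also have "\<dots> = \<Squnion>\<^bsub>F\<^esub>(g ` (\<lambda>x. rad_gen A {x}) ` I)"
    using g X unfolding Frm_hom_def by blast
  also have "g ` (\<lambda>x. rad_gen A {x}) ` I = Rad_transpose A g ` I"
    unfolding image_image using Is
    by (intro image_cong) (auto simp: Rad_transpose_def comp_mor_def compose_def Rad_unit_def)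
  finally show ?thesis .
qed

lemma bij_betw_Rad_transpose:
  "bij_betw (Rad_transpose A) (Frm_hom (Rad A) F) (OSR_hom A (frame_osr F))"
proof (rule bij_betwI[where g = "\<lambda>f. \<lambda>I\<in>carrier (Rad A). \<Squnion>\<^bsub>F\<^esub>(f ` I)"])
  show "Rad_transpose A \<in> Frm_hom (Rad A) F \<rightarrow> OSR_hom A (frame_osr F)"
    unfolding Rad_transpose_def
    by (intro funcsetI comp_mor_OSR_hom[where B = "frame_osr (Rad A)"] Rad_unit_OSR_hom
        ord_semiring_frame_osr Frm_hom_OSR_hom osr frame frame_Rad)
  show "(\<lambda>f. \<lambda>I\<in>carrier (Rad A). \<Squnion>\<^bsub>F\<^esub>(f ` I)) \<in> OSR_hom A (frame_osr F) \<rightarrow> Frm_hom (Rad A) F"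
    by (intro funcsetI extension_Frm_hom)
  show "(\<lambda>I\<in>carrier (Rad A). \<Squnion>\<^bsub>F\<^esub>(Rad_transpose A g ` I)) = g"
    if "g \<in> Frm_hom (Rad A) F" for g
  proof
    fix I
    show "(\<lambda>I\<in>carrier (Rad A). \<Squnion>\<^bsub>F\<^esub>(Rad_transpose A g ` I)) I = g I"
      using Frm_hom_Rad_apply[OF that, of I] that
      by (auto simp: Frm_hom_def PiE_def extensional_def)
  qed
qed (rule Rad_transpose_extension)

end

section \<open>\<open>Rad\<close> on morphisms, and naturality of transposition\<close>

lemma Rad_map_Frm_hom:
  assumes osr: "ord_semiring A" "ord_semiring B" and f: "f \<in> OSR_hom A B"
  shows "Rad_map A B f \<in> Frm_hom (Rad A) (Rad B)"
proof -
  \<comment> \<open>\<open>Rad_map A B f\<close> turns out to be the extension of this composite, so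
    \<open>extension_Frm_hom\<close> applies with \<open>Rad B\<close> as the frame.\<close>
  let ?f = "comp_mor A (Rad_unit B) f"
  have hom: "?f \<in> OSR_hom A (frame_osr (Rad B))"
    by (rule comp_mor_OSR_hom[OF osr ord_semiring_frame_osr[OF frame_Rad[OF osr(2)]] f
          Rad_unit_OSR_hom[OF osr(2)]])
  have "\<Squnion>\<^bsub>Rad B\<^esub>(?f ` I) = rad_gen B (f ` I)" if "radical_ideal A I" for I
  proof -
    have I: "I \<subseteq> carrier A" by (rule radical_ideal_subset[OF that])
    have fI: "f ` I \<subseteq> carrier B" by (rule OSR_hom_image[OF osr f I])
    have "?f ` I = (\<lambda>x. rad_gen B {x}) ` f ` I"
      unfolding image_image using I fI
      by (intro image_cong) (auto simp: comp_mor_def compose_def Rad_unit_def)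
    then show ?thesis by (simp only: Rad_sup_principal[OF osr(2) fI])
  qed
  then have "Rad_map A B f = (\<lambda>I\<in>carrier (Rad A). \<Squnion>\<^bsub>Rad B\<^esub>(?f ` I))"
    by (auto simp: Rad_map_def intro!: restrict_ext)
  then show ?thesis using extension_Frm_hom[OF osr(1) frame_Rad[OF osr(2)] hom] by simp
qed

text \<open>At \<open>x\<close> in the carrier both sides equal
  \<open>h (g (rad_gen B {f x}))\<close>, by naturality of the unit. Using \<open>f\<close> and
  \<open>h\<close> together treats both variables at once.\<close>

lemma Rad_transpose_natural:
  assumes osr: "ord_semiring A" "ord_semiring B" and f: "f \<in> OSR_hom A B"
  shows "Rad_transpose A (comp_mor (Rad A) h (comp_mor (Rad A) g (Rad_map A B f))) =
    comp_mor A h (comp_mor A (Rad_transpose B g) f)"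
proof
  fix x
  show "Rad_transpose A (comp_mor (Rad A) h (comp_mor (Rad A) g (Rad_map A B f))) x =
    comp_mor A h (comp_mor A (Rad_transpose B g) f) x"
    using radical_ideal_rad_gen[OF osr(1), of "{x}"] OSR_hom_closed[OF osr f, of x]
      Rad_map_rad_gen[OF osr f, of x]
    by (simp add: Rad_transpose_def comp_mor_def compose_def Rad_unit_def)
qed

theorem corollary5p2:
  shows
    \<comment> \<open>the inclusion is a functor from frames to ordered semirings\<close>
    "(\<forall>F::'u gorder. frame F \<longrightarrow> ord_semiring (frame_osr F)) \<and>
     (\<forall>(F::'u gorder) (G::'v gorder). frame F \<and> frame G \<longrightarrow>
        Frm_hom F G \<subseteq> OSR_hom (frame_osr F) (frame_osr G)) \<and>
     (\<forall>F::'u gorder. frame F \<longrightarrow> id_mor (frame_osr F) = id_mor F) \<and>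
     (\<forall>(F::'u gorder) (G::'v gorder) (H::'w gorder) h k.
        frame F \<and> frame G \<and> frame H \<and> h \<in> Frm_hom F G \<and> k \<in> Frm_hom G H \<longrightarrow>
        comp_mor (frame_osr F) k h = comp_mor F k h) \<and>
     \<comment> \<open>\<open>Rad\<close> is a functor from ordered semirings to frames\<close>
     (\<forall>A::'a ord_semiring. ord_semiring A \<longrightarrow> frame (Rad A)) \<and>
     (\<forall>(A::'a ord_semiring) (B::'b ord_semiring) f.
        ord_semiring A \<and> ord_semiring B \<and> f \<in> OSR_hom A B \<longrightarrow>
        Rad_map A B f \<in> Frm_hom (Rad A) (Rad B)) \<and>
     (\<forall>A::'a ord_semiring. ord_semiring A \<longrightarrow> Rad_map A A (id_mor A) = id_mor (Rad A)) \<and>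
     (\<forall>(A::'a ord_semiring) (B::'b ord_semiring) (C::'c ord_semiring) f g.
        ord_semiring A \<and> ord_semiring B \<and> ord_semiring C \<and> f \<in> OSR_hom A B \<and> g \<in> OSR_hom B C \<longrightarrow>
        Rad_map A C (comp_mor A g f) = comp_mor (Rad A) (Rad_map B C g) (Rad_map A B f)) \<and>
     \<comment> \<open>transposition is a bijection of hom-sets, natural in both variables\<close>
     (\<forall>(A::'a ord_semiring) (F::'u gorder). ord_semiring A \<and> frame F \<longrightarrow>
        bij_betw (Rad_transpose A) (Frm_hom (Rad A) F) (OSR_hom A (frame_osr F))) \<and>
     (\<forall>(A::'a ord_semiring) (B::'b ord_semiring) (F::'u gorder) (G::'v gorder) f g h.
        ord_semiring A \<and> ord_semiring B \<and> frame F \<and> frame G \<and>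
        f \<in> OSR_hom A B \<and> g \<in> Frm_hom (Rad B) F \<and> h \<in> Frm_hom F G \<longrightarrow>
        Rad_transpose A (comp_mor (Rad A) h (comp_mor (Rad A) g (Rad_map A B f))) =
        comp_mor A h (comp_mor A (Rad_transpose B g) f))"
  \<comment> \<open>The clauses left to \<open>simp\<close> concern identities and composites; they
    hold because \<open>frame_osr\<close> keeps the carrier.\<close>
  by (intro conjI allI impI subsetI; (elim conjE)?;
      ((rule ord_semiring_frame_osr Frm_hom_OSR_hom frame_Rad Rad_map_Frm_hom Rad_map_id Rad_map_comp
          bij_betw_Rad_transpose Rad_transpose_natural; assumption) |
       (simp add: id_mor_def comp_mor_def)))

end
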